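(* Let $G=(V,E)$ be a graph with $n$ nodes, let $\lambda,\delta\in(0,1)$, and run the sampling algorithm described in the context, with deterministic values $\delta_L(v),\delta_U(v)>0$ ($v\in V$) fixed before any sampling and satisfying $\sum_{v\in V}(\delta_L(v)+\delta_U(v))\le \delta/2$, and with an arbitrary stopping rule such that the decision to stop after $t$ samples depends only on the first $t$ sampled paths. Let $\tilde b(v)$ be the output and $\tau$ the number of samples taken when the algorithm stops. Then, with probability at least $1-\delta$, the following both hold: (i) if $\tau=\omega$, then $|\tilde b(v)-b(v)|<\lambda$ for all $v\in V$; (ii) if $\tau<\omega$, then $-f(\tilde b(v),\delta_L(v),\omega,\tau)\le b(v)-\tilde b(v)\le g(\tilde b(v),\delta_U(v),\omega,\tau)$ for all $v\in V$.
   Context: The normalized betweenness centrality of $v$ is $b(v)=\frac{1}{n(n-1)}\sum_{s\ne v\ne t}\frac{\sigma_{st}(v)}{\sigma_{st}}$, where $\sigma_{st}$ is the number of shortest $s$–$t$ paths and $\sigma_{st}(v)$ the number of those passing through $v$. A random path $\pi$ is sampled by choosing two nodes $s,t$ uniformly at random and then one shortest $s$–$t$ path uniformly at random; then $\Pr(v\in\pi,\ v\ne s,t)=b(v)$. The algorithm sets $\omega=\frac{c}{\lambda^2}\big(\lfloor\log_2(VD-2)\rfloor+1+\log\frac{2}{\delta}\big)$, where $VD$ is the vertex diameter of $G$ (maximum number of nodes on a shortest path) and $c$ is the universal constant of the Riondato–Kornaropoulos sample bound, which guarantees that after $\omega$ independent samples the estimate satisfies $\max_v|\tilde b(v)-b(v)|\le\lambda$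 with probability at least $1-\delta/2$. It then samples independent paths $\pi_1,\pi_2,\dots$ until either $\omega$ paths have been sampled or the stopping rule says to stop; if $\tau$ paths were sampled, it outputs $\tilde b(v)=\frac1\tau\sum_{i=1}^\tau X_i(v)$, where $X_i(v)=1$ if $v$ is an internal node of $\pi_i$ and $0$ otherwise. The functions are $f(\tilde b,\delta_L,\omega,\tau)=\frac{1}{\tau}\log\frac{1}{\delta_L}\Big(\frac13-\frac{\omega}{\tau}+\sqrt{(\frac13-\frac{\omega}{\tau})^2+\frac{2\tilde b\omega}{\log(1/\delta_L)}}\Big)$ and $g(\tilde b,\delta_U,\omega,\tau)=\frac{1}{\tau}\log\frac{1}{\delta_U}\Big(\frac13+\frac{\omega}{\tau}+\sqrt{(\frac13+\frac{\omega}{\tau})^2+\frac{2\tilde b\omega}{\log(1/\delta_U)}}\Big)$. *)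

theory Defs
  imports "HOL-Probability.Probability" "Graph_Theory.Graph_Theory"
begin

text \<open>
  A path is the list of its nodes. In a graph without parallel arcs this determines the arcs.
  An undirected graph is a symmetric digraph (locale \<open>graph\<close>, a sublocale of \<open>digraph\<close>).
\<close>

definition shortest_paths :: "('a, 'b) pre_digraph \<Rightarrow> 'a \<Rightarrow> 'a \<Rightarrow> 'a list set" where
  "shortest_paths G s t =
     {p. vpath p G \<and> hd p = s \<and> last p = t \<and>
         (\<forall>q. vpath q G \<and> hd q = s \<and> last q = t \<longrightarrow> length p \<le> length q)}"

definition num_sp :: "('a, 'b) pre_digraph \<Rightarrow> 'a \<Rightarrow> 'a \<Rightarrow> nat" where
  "num_sp G s t = card (shortest_paths G s t)"

definition num_sp_through :: "('a, 'b) pre_digraph \<Rightarrow> 'a \<Rightarrow> 'a \<Rightarrow> 'a \<Rightarrow> nat" where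
  "num_sp_through G s t v = card {p \<in> shortest_paths G s t. v \<in> set p}"

text \<open>Pairs with \<open>t\<close> unreachable from \<open>s\<close> contribute \<open>0 / 0 = 0\<close>; pairs with \<open>s = t\<close> contribute \<open>0\<close>.\<close>

definition betweenness :: "('a, 'b) pre_digraph \<Rightarrow> 'a \<Rightarrow> real" where
  "betweenness G v =
     1 / (real (card (verts G)) * (real (card (verts G)) - 1)) *
     (\<Sum>(s, t) \<in> {(s, t). s \<in> verts G \<and> t \<in> verts G \<and> s \<noteq> v \<and> v \<noteq> t}.
        real (num_sp_through G s t v) / real (num_sp G s t))"

definition vertex_diameter :: "('a, 'b) pre_digraph \<Rightarrow> nat" where
  "vertex_diameter G =
     Max {length p | p s t. s \<in> verts G \<and> t \<in> verts G \<and> p \<in> shortest_paths G s t}"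

text \<open>
  The two endpoints are distinct, in accordance with the factor \<open>1 / (n (n - 1))\<close> of the
  betweenness. If \<open>t\<close> is unreachable from \<open>s\<close>, the sample is the empty path.
\<close>

definition sample_path :: "('a, 'b) pre_digraph \<Rightarrow> 'a list pmf" where
  "sample_path G =
     pmf_of_set {(s, t). s \<in> verts G \<and> t \<in> verts G \<and> s \<noteq> t} \<bind>
       (\<lambda>(s, t). if shortest_paths G s t = {} then return_pmf []
                 else pmf_of_set (shortest_paths G s t))"

definition internal_node :: "'a \<Rightarrow> 'a list \<Rightarrow> bool" where
  "internal_node v p \<longleftrightarrow> v \<in> set p \<and> v \<noteq> hd p \<and> v \<noteq> last p"

definition estimate :: "'a list list \<Rightarrow> 'a \<Rightarrow> real" where
  "estimate ps v = 1 / real (length ps) * (\<Sum>p\<leftarrow>ps. if internal_node v p then 1 else 0)"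

text \<open>
  The bound is rounded up to make it a number of samples. For \<open>VD \<le> 2\<close> (no shortest path has an
  internal node) the logarithm of \<open>VD - 2\<close> is undefined and its floor is taken to be \<open>0\<close>.
\<close>

definition max_samples :: "('a, 'b) pre_digraph \<Rightarrow> real \<Rightarrow> real \<Rightarrow> real \<Rightarrow> nat" where
  "max_samples G c \<epsilon> \<delta> =
     nat \<lceil>c / \<epsilon>\<^sup>2 *
          ((if vertex_diameter G \<le> 2 then 0
            else real_of_int \<lfloor>log 2 (real (vertex_diameter G) - 2)\<rfloor>) + 1 + ln (2 / \<delta>))\<rceil>"

text \<open>
  The Riondato--Kornaropoulos sample bound on \<open>G\<close>, for all accuracies and failure probabilities.
  The universal constant is a \<open>c\<close> for which this holds on every \<open>G\<close>.
\<close>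

definition rk_sample_bound :: "('a, 'b) pre_digraph \<Rightarrow> real \<Rightarrow> bool" where
  "rk_sample_bound G c \<longleftrightarrow> 0 < c \<and>
     (\<forall>\<epsilon> \<in> {0<..<1}. \<forall>\<delta> \<in> {0<..<1}.
        measure_pmf.prob (replicate_pmf (max_samples G c \<epsilon> \<delta>) (sample_path G))
          {ps. \<forall>v \<in> verts G. \<bar>estimate ps v - betweenness G v\<bar> \<le> \<epsilon>} \<ge> 1 - \<delta> / 2)"

text \<open>
  \<open>adaptive_run D stop k ps\<close> is the distribution of the list of all samples when the loop ends, if
  \<open>ps\<close> are the samples so far and at most \<open>k\<close> more may be drawn (independently from \<open>D\<close>). The
  stopping rule is a function of the samples drawn so far, consulted after each sample.
\<close>

primrec adaptive_run :: "'p pmf \<Rightarrow> ('p list \<Rightarrow> bool) \<Rightarrow> nat \<Rightarrow> 'p list \<Rightarrow> 'p list pmf" where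
  "adaptive_run D stop 0 ps = return_pmf ps"
| "adaptive_run D stop (Suc k) ps =
     D \<bind> (\<lambda>p. if stop (ps @ [p]) then return_pmf (ps @ [p])
                else adaptive_run D stop k (ps @ [p]))"

definition err_lower :: "real \<Rightarrow> real \<Rightarrow> nat \<Rightarrow> nat \<Rightarrow> real" where
  "err_lower b \<delta> \<omega> \<tau> =
     1 / real \<tau> * ln (1 / \<delta>) *
     (1 / 3 - real \<omega> / real \<tau> +
      sqrt ((1 / 3 - real \<omega> / real \<tau>)\<^sup>2 + 2 * b * real \<omega> / ln (1 / \<delta>)))"

definition err_upper :: "real \<Rightarrow> real \<Rightarrow> nat \<Rightarrow> nat \<Rightarrow> real" where
  "err_upper b \<delta> \<omega> \<tau> =
     1 / real \<tau> * ln (1 / \<delta>) *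
     (1 / 3 + real \<omega> / real \<tau> +
      sqrt ((1 / 3 + real \<omega> / real \<tau>)\<^sup>2 + 2 * b * real \<omega> / ln (1 / \<delta>)))"

end

theory Submission
  imports Defs
begin

text \<open>
  For a stopping time bounded by \<open>\<omega>\<close>, the products of \<open>exp (\<theta> (X\<^sub>i(v) - b(v)) - m)\<close> form a
  supermartingale whenever \<open>m\<close> dominates the logarithmic moment generating function of one
  summand. Markov's inequality then gives a Bernstein tail bound for \<open>\<Sum>\<^sub>i (X\<^sub>i(v) - b(v))\<close> with variance
  proxy \<open>\<omega> b(v)\<close>, whatever the stopping rule. The threshold depends on the unknown \<open>b(v)\<close>; solving
  the resulting quadratic inequality for \<open>b(v)\<close> turns it into the bounds \<open>f\<close> and \<open>g\<close>.

  If all \<open>\<omega>\<close> samples are drawn, the run coincides with \<open>\<omega>\<close> independent samples, so the sample bound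
  applies. It only yields a non-strict inequality; the strict one follows by applying it to a smaller
  accuracy and a larger failure probability for which the number of samples is the same, and letting
  the failure probability tend to \<open>\<delta>\<close>.
\<close>

section \<open>Runs with a stopping rule\<close>

text \<open>The rule is consulted only after a draw, hence the strict inequality; it later keeps
  \<open>estimate\<close> from dividing by zero.\<close>

lemma length_adaptive_run:
  "xs \<in> set_pmf (adaptive_run D stop k ps) \<Longrightarrow>
    length ps \<le> length xs \<and> length xs \<le> length ps + k \<and> (0 < k \<longrightarrow> length ps < length xs)"
proof (induction k arbitrary: ps)
  case (Suc k)
  then obtain p where
    "xs \<in> set_pmf (if stop (ps @ [p]) then return_pmf (ps @ [p]) else adaptive_run D stop k (ps @ [p]))"
    by auto
  then show ?case
    using Suc.IH[of "ps @ [p]"] by (auto split: if_splits)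
qed simp

text \<open>Supermartingale property: each new factor is independent of the past and has mean at
  most 1, so neither stopping nor continuing can raise the expected product. Values in
  \<open>ennreal\<close> avoid integrability conditions.\<close>

lemma nn_integral_adaptive_run_prod_le:
  fixes w :: "'p \<Rightarrow> ennreal"
  assumes "(\<integral>\<^sup>+ x. w x \<partial>measure_pmf D) \<le> 1"
  shows "(\<integral>\<^sup>+ xs. prod_list (map w xs) \<partial>measure_pmf (adaptive_run D stop k ps))
           \<le> prod_list (map w ps)"
proof (induction k arbitrary: ps)
  case (Suc k)
  have "(\<integral>\<^sup>+ xs. prod_list (map w xs) \<partial>measure_pmf (adaptive_run D stop (Suc k) ps))
      \<le> (\<integral>\<^sup>+ p. prod_list (map w ps) * w p \<partial>measure_pmf D)"
    using Suc.IH[of "ps @ [_]"] by (auto intro!: nn_integral_mono)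
  also have "\<dots> = prod_list (map w ps) * (\<integral>\<^sup>+ p. w p \<partial>measure_pmf D)"
    by (simp add: nn_integral_cmult)
  also have "\<dots> \<le> prod_list (map w ps)"
    using mult_left_mono[OF assms, of "prod_list (map w ps)"] by simp
  finally show ?case .
qed simp

lemma prod_list_exp:
  "prod_list (map (\<lambda>x. ennreal (exp (h x))) xs) = ennreal (exp (sum_list (map h xs)))"
  by (induction xs) (auto simp: exp_add ennreal_mult)

text \<open>A run of maximal length has seen exactly \<open>k\<close> independent draws; stopping
  early only removes outcomes from the event.\<close>

lemma prob_adaptive_run_full_le:
  "measure_pmf.prob (adaptive_run D stop k ps) {xs. length xs = length ps + k \<and> P xs}
    \<le> measure_pmf.prob (replicate_pmf k D) {qs. P (ps @ qs)}"
proof (induction k arbitrary: ps)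
  case 0
  show ?case by (auto simp: indicator_def)
next
  case (Suc k)
  let ?A = "{xs. length xs = length ps + Suc k \<and> P xs}"
  have step: "emeasure (measure_pmf (if stop (ps @ [p]) then return_pmf (ps @ [p])
                else adaptive_run D stop k (ps @ [p]))) ?A
      \<le> emeasure (measure_pmf (replicate_pmf k D)) {qs. P (ps @ p # qs)}" for p
  proof (cases "stop (ps @ [p])")
    case True
    \<comment> \<open>If the rule fires with \<open>k > 0\<close>, the run is too short for
      \<open>?A\<close>; with \<open>k = 0\<close> it has full length and both sides agree.\<close>
    then show ?thesis by (cases k) (auto simp: indicator_def)
  next
    case False
    then show ?thesis
      using Suc.IH[of "ps @ [p]"] by (simp add: measure_pmf.emeasure_eq_measure)
  qed
  have "emeasure (measure_pmf (adaptive_run D stop (Suc k) ps)) ?A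
      = (\<integral>\<^sup>+ p. emeasure (measure_pmf (if stop (ps @ [p]) then return_pmf (ps @ [p])
                else adaptive_run D stop k (ps @ [p]))) ?A \<partial>measure_pmf D)"
    by (simp add: emeasure_bind_pmf)
  also have "\<dots> \<le> (\<integral>\<^sup>+ p. emeasure (measure_pmf (replicate_pmf k D)) {qs. P (ps @ p # qs)}
                   \<partial>measure_pmf D)"
    by (intro nn_integral_mono step)
  also have "\<dots> = emeasure (measure_pmf (replicate_pmf (Suc k) D)) {qs. P (ps @ qs)}"
    by (simp add: emeasure_bind_pmf map_pmf_def[symmetric] vimage_def)
  finally show ?case
    by (simp add: measure_pmf.emeasure_eq_measure)
qed

lemma prob_adaptive_run_sum_ge_le:
  fixes h :: "'p \<Rightarrow> real"
  assumes mgf: "(\<integral>\<^sup>+ x. ennreal (exp (\<theta> * h x - m)) \<partial>measure_pmf D) \<le> 1"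
    and "0 \<le> \<theta>" "0 \<le> m"
  shows "measure_pmf.prob (adaptive_run D stop k []) {xs. a \<le> sum_list (map h xs)}
           \<le> exp (m * real k - \<theta> * a)"
proof -
  let ?M = "measure_pmf (adaptive_run D stop k [])"
  let ?A = "{xs. a \<le> sum_list (map h xs)}"
  let ?w = "\<lambda>x. ennreal (exp (\<theta> * h x - m))"
  \<comment> \<open>Pointwise form of Markov's inequality. A run has at most \<open>k\<close>
    factors, and as \<open>0 \<le> m\<close> the total correction is at most \<open>m * k\<close>
    wherever the run stops.\<close>
  have "ennreal (exp (\<theta> * a - m * real k)) * indicator ?A xs \<le> prod_list (map ?w xs)"
    if "xs \<in> set_pmf (adaptive_run D stop k [])" for xs
  proof -
    have "length xs \<le> k"
      using length_adaptive_run[OF that] by simp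
    then have "m * real (length xs) \<le> m * real k"
      using \<open>0 \<le> m\<close> by (intro mult_left_mono) auto
    moreover have "\<theta> * a \<le> \<theta> * sum_list (map h xs)" if "xs \<in> ?A"
      using that \<open>0 \<le> \<theta>\<close> by (intro mult_left_mono) auto
    moreover have "sum_list (map (\<lambda>x. \<theta> * h x - m) xs)
        = \<theta> * sum_list (map h xs) - m * real (length xs)"
      by (induction xs) (auto simp: algebra_simps)
    ultimately show ?thesis
      by (auto simp: prod_list_exp indicator_def intro!: ennreal_leI)
  qed
  then have "(\<integral>\<^sup>+ xs. ennreal (exp (\<theta> * a - m * real k)) * indicator ?A xs \<partial>?M)
      \<le> (\<integral>\<^sup>+ xs. prod_list (map ?w xs) \<partial>?M)"
    by (intro nn_integral_mono_AE) (auto simp: AE_measure_pmf_iff)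
  also have "\<dots> \<le> 1"
    using nn_integral_adaptive_run_prod_le[OF mgf, of stop k "[]"] by simp
  finally have "ennreal (exp (\<theta> * a - m * real k) * measure_pmf.prob (adaptive_run D stop k []) ?A)
      \<le> ennreal 1"
    by (simp add: nn_integral_cmult_indicator measure_pmf.emeasure_eq_measure ennreal_mult)
  then have "exp (\<theta> * a - m * real k) * measure_pmf.prob (adaptive_run D stop k []) ?A \<le> 1"
    by (subst (asm) ennreal_le_iff) auto
  then show ?thesis
    by (simp add: exp_diff field_simps)
qed

section \<open>Bernstein's inequality\<close>

text \<open>Allows the exponential series from degree 2 on to be compared with a geometric series of
  ratio |x|/3; this is the origin of the 1/3 in f and g.\<close>

lemma two_times_power_three_le_fact: "2 * 3 ^ n \<le> (fact (n + 2) :: real)"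
proof (induction n)
  case (Suc n)
  have "2 * 3 ^ Suc n \<le> 3 * (fact (n + 2) :: real)"
    using Suc by (simp del: fact_Suc)
  also have "\<dots> \<le> real (n + 3) * fact (n + 2)"
    by (intro mult_right_mono) auto
  also have "\<dots> = fact (Suc n + 2)"
    by (simp add: algebra_simps)
  finally show ?case .
qed (simp add: fact_numeral)

lemma exp_minus_one_minus_le:
  fixes x :: real
  assumes "\<bar>x\<bar> < 3"
  shows "exp x - 1 - x \<le> x\<^sup>2 / (2 * (1 - \<bar>x\<bar> / 3))"
proof -
  let ?e = "\<lambda>n. x ^ n /\<^sub>R fact n"
  have "(\<lambda>n. ?e (n + 2)) sums (exp x - (\<Sum>i<2. ?e i))"
    using exp_converges[of x] by (rule sums_split_initial_segment)
  then have "(\<lambda>n. ?e (n + 2)) sums (exp x - 1 - x)"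
    by (simp add: numeral_2_eq_2 algebra_simps)
  moreover have "(\<lambda>n. x\<^sup>2 / 2 * (\<bar>x\<bar> / 3) ^ n) sums (x\<^sup>2 / 2 * (1 / (1 - \<bar>x\<bar> / 3)))"
    using assms by (intro sums_mult geometric_sums) simp
  moreover have "?e (n + 2) \<le> x\<^sup>2 / 2 * (\<bar>x\<bar> / 3) ^ n" for n
  proof -
    have "?e (n + 2) \<le> \<bar>x\<bar> ^ (n + 2) / fact (n + 2)"
      using abs_ge_self[of "x ^ (n + 2)"]
      by (simp add: power_abs[symmetric] divide_inverse mult.commute mult_left_mono
          del: power_Suc add_2_eq_Suc' fact_Suc)
    also have "\<dots> \<le> \<bar>x\<bar> ^ (n + 2) / (2 * 3 ^ n)"
      using two_times_power_three_le_fact[of n] by (intro divide_left_mono) auto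
    also have "\<dots> = x\<^sup>2 / 2 * (\<bar>x\<bar> / 3) ^ n"
      by (simp add: power_add power_divide power2_eq_square)
    finally show ?thesis .
  qed
  ultimately have "exp x - 1 - x \<le> x\<^sup>2 / 2 * (1 / (1 - \<bar>x\<bar> / 3))"
    by (rule sums_le[rotated])
  then show ?thesis by simp
qed

text \<open>For an indicator X of mean b, E exp(\<theta> X) = 1 + (exp \<theta> - 1) b \<le>
  exp((exp \<theta> - 1) b); centering removes the factor exp(\<theta> b).\<close>

lemma nn_integral_exp_centered_indicator_le:
  fixes \<theta> :: real
  assumes b: "b = measure_pmf.prob D {x. P x}"
    and m: "b * (exp \<theta> - 1 - \<theta>) \<le> m"
  shows "(\<integral>\<^sup>+ x. ennreal (exp (\<theta> * (of_bool (P x) - b) - m)) \<partial>measure_pmf D) \<le> 1"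
proof -
  have "(\<integral>\<^sup>+ x. ennreal (exp (\<theta> * (of_bool (P x) - b) - m)) \<partial>measure_pmf D)
      = (\<integral>\<^sup>+ x. ennreal (exp (- \<theta> * b - m) * (1 + (exp \<theta> - 1) * indicator {x. P x} x))
           \<partial>measure_pmf D)"
    by (intro nn_integral_cong) (auto simp: indicator_def exp_add[symmetric] algebra_simps)
  also have "\<dots> = ennreal (measure_pmf.expectation D
      (\<lambda>x. exp (- \<theta> * b - m) * (1 + (exp \<theta> - 1) * indicator {x. P x} x)))"
    by (intro nn_integral_eq_integral AE_pmfI)
       (auto intro!: integrable_mult_right Bochner_Integration.integrable_add
          integrable_real_indicator simp: less_top[symmetric] split: split_indicator)
  also have "measure_pmf.expectation D
      (\<lambda>x. exp (- \<theta> * b - m) * (1 + (exp \<theta> - 1) * indicator {x. P x} x))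
      = exp (- \<theta> * b - m) * (1 + (exp \<theta> - 1) * b)"
    by (subst integral_mult_right_zero, subst Bochner_Integration.integral_add)
       (auto simp: b intro!: integrable_mult_right integrable_real_indicator
          simp: less_top[symmetric])
  also have "ennreal (exp (- \<theta> * b - m) * (1 + (exp \<theta> - 1) * b))
      \<le> ennreal (exp (- \<theta> * b - m) * exp ((exp \<theta> - 1) * b))"
    by (intro ennreal_leI mult_left_mono exp_ge_add_one_self) auto
  also have "\<dots> \<le> ennreal 1"
    using m by (intro ennreal_leI) (simp add: exp_add[symmetric] algebra_simps)
  finally show ?thesis by simp
qed

text \<open>The positive root x of x^2 = 2 L (u + x/3), that is, the deviation at which Bernstein's
  exponent x^2 / (2 (u + x/3)) equals L for total variance u.\<close>

definition bernstein_threshold :: "real \<Rightarrow> real \<Rightarrow> real" where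
  "bernstein_threshold L u = L / 3 + sqrt ((L / 3)\<^sup>2 + 2 * u * L)"

lemma bernstein_threshold_pos:
  assumes "0 < L" "0 \<le> u"
  shows "0 < bernstein_threshold L u"
  using assms unfolding bernstein_threshold_def by (intro add_pos_nonneg) auto

lemma bernstein_threshold_square:
  assumes "0 < L" "0 \<le> u"
  shows "(bernstein_threshold L u)\<^sup>2 = 2 * L * (u + bernstein_threshold L u / 3)"
proof -
  have "(bernstein_threshold L u - L / 3)\<^sup>2 = (L / 3)\<^sup>2 + 2 * u * L"
    using assms by (simp add: bernstein_threshold_def)
  then show ?thesis by (simp add: power2_eq_square algebra_simps)
qed

text \<open>The sign \<open>s\<close> treats both tails at once. The variance term uses the maximal
  length \<open>k\<close>, not the random length of the run.\<close>

lemma prob_adaptive_run_bernstein: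
  assumes b: "b = measure_pmf.prob D {x. P x}" and L: "0 < L" and s: "\<bar>s\<bar> = 1"
  shows "measure_pmf.prob (adaptive_run D stop k [])
           {xs. bernstein_threshold L (real k * b) \<le> (\<Sum>x\<leftarrow>xs. s * (of_bool (P x) - b))}
         \<le> exp (- L)"
proof -
  define u where "u = real k * b"
  define a where "a = bernstein_threshold L u"
  have b0: "0 \<le> b" by (simp add: b)
  then have u: "0 \<le> u" by (simp add: u_def)
  have a: "0 < a" "a\<^sup>2 = 2 * L * (u + a / 3)"
    using bernstein_threshold_pos bernstein_threshold_square L u by (auto simp: a_def)
  obtain \<theta> where \<theta>: "0 \<le> \<theta>" "\<theta> < 3" "u * (\<theta>\<^sup>2 / (2 * (1 - \<theta> / 3))) - \<theta> * a \<le> - L"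
  \<comment> \<open>For \<open>u = 0\<close> the choice below would give \<theta> = 3, where the
    bound on the exponential breaks down. Since then a = 2L/3, the value 3/2 gives \<theta> a =
    L.\<close>
  proof (cases "u = 0")
    case True
    then have "a = 2 * L / 3"
      using a by (simp add: power2_eq_square)
    then show ?thesis
      using True by (intro that[of "3 / 2"]) auto
  next
    case False
    then have u': "0 < u" using u by simp
    \<comment> \<open>Bernstein's choice: the variance term becomes a^2 / (2 (u + a/3)) = L and
      \<theta> a becomes 2L, leaving -L in the exponent.\<close>
    define \<theta> where "\<theta> = a / (u + a / 3)"
    have d: "0 < u + a / 3" using u' a by simp
    have 1: "1 - \<theta> / 3 = u / (u + a / 3)"
      using d by (simp add: \<theta>_def field_simps)
    have "u * (\<theta>\<^sup>2 / (2 * (1 - \<theta> / 3))) = a\<^sup>2 / (2 * (u + a / 3))"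
      unfolding 1 using d u' by (simp add: \<theta>_def power2_eq_square divide_simps)
    also have "\<dots> = L"
      using a(2) d by (simp add: divide_eq_eq)
    finally have "u * (\<theta>\<^sup>2 / (2 * (1 - \<theta> / 3))) = L" .
    moreover have "\<theta> * a = 2 * L"
      using a(2) d by (simp add: \<theta>_def power2_eq_square field_simps)
    moreover have "\<theta> < 3" "0 \<le> \<theta>"
      using d u' a by (auto simp: \<theta>_def field_simps)
    ultimately show ?thesis by (intro that[of \<theta>]) auto
  qed
  \<comment> \<open>The bound on exp x - 1 - x depends only on |x|, so one \<open>m\<close> serves
    both signs of \<open>s\<close>.\<close>
  define m where "m = b * (\<theta>\<^sup>2 / (2 * (1 - \<theta> / 3)))"
  have abs_s: "\<bar>s * \<theta>\<bar> = \<theta>" "(s * \<theta>)\<^sup>2 = \<theta>\<^sup>2"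
    using s \<theta>(1) by (auto simp: abs_mult power_mult_distrib abs_eq_iff' power2_eq_1_iff)
  have "b * (exp (s * \<theta>) - 1 - s * \<theta>) \<le> m"
    unfolding m_def using exp_minus_one_minus_le[of "s * \<theta>"] \<theta> b0 abs_s
    by (intro mult_left_mono) auto
  from nn_integral_exp_centered_indicator_le[OF b this]
  have "(\<integral>\<^sup>+ x. ennreal (exp (\<theta> * (s * (of_bool (P x) - b)) - m)) \<partial>measure_pmf D) \<le> 1"
    by (simp add: mult_ac)
  moreover have "0 \<le> m"
    using b0 \<theta> by (auto simp: m_def)
  ultimately have "measure_pmf.prob (adaptive_run D stop k [])
      {xs. a \<le> (\<Sum>x\<leftarrow>xs. s * (of_bool (P x) - b))} \<le> exp (m * real k - \<theta> * a)"
    using \<theta>(1) by (intro prob_adaptive_run_sum_ge_le)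
  also have "\<dots> \<le> exp (- L)"
    using \<theta>(3) by (simp add: m_def u_def mult_ac)
  finally show ?thesis by (simp add: a_def u_def)
qed

section \<open>Inverting the tail bound\<close>

lemma le_quadratic_root:
  fixes y a c :: real
  assumes "y\<^sup>2 \<le> 2 * a * y + c"
  shows "y \<le> a + sqrt (a\<^sup>2 + c)"
proof -
  have "(y - a)\<^sup>2 \<le> a\<^sup>2 + c"
    using assms by (simp add: power2_eq_square algebra_simps)
  then have "y - a \<le> sqrt (a\<^sup>2 + c)"
    by (rule real_le_rsqrt)
  then show ?thesis by simp
qed

text \<open>The smaller root of the quadratic is at most 0, so a nonnegative \<open>y\<close> below
  the threshold lies between the two roots.\<close>

lemma square_le_if_less_bernstein_threshold:
  assumes "y < bernstein_threshold L u" "0 \<le> y" "0 < L" "0 \<le> u"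
  shows "y\<^sup>2 \<le> 2 * (L / 3) * y + 2 * u * L"
proof -
  let ?r = "sqrt ((L / 3)\<^sup>2 + 2 * u * L)"
  have "L / 3 \<le> ?r"
    using assms by (intro real_le_rsqrt) auto
  then have "\<bar>y - L / 3\<bar> \<le> ?r"
    using assms by (auto simp: bernstein_threshold_def)
  then have "(y - L / 3)\<^sup>2 \<le> (L / 3)\<^sup>2 + 2 * u * L"
    using assms by (simp add: sqrt_ge_absD)
  then show ?thesis by (simp add: power2_eq_square algebra_simps)
qed

lemma scaled_quadratic_root:
  fixes L a c :: real
  assumes "0 < L"
  shows "L * (a + sqrt (a\<^sup>2 + c / L)) = L * a + sqrt ((L * a)\<^sup>2 + c * L)"
proof -
  have "L * sqrt (a\<^sup>2 + c / L) = sqrt (L\<^sup>2 * (a\<^sup>2 + c / L))"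
    using assms by (simp add: real_sqrt_mult)
  also have "L\<^sup>2 * (a\<^sup>2 + c / L) = (L * a)\<^sup>2 + c * L"
    using assms by (simp add: power2_eq_square field_simps)
  finally show ?thesis by (simp add: distrib_left)
qed

text \<open>With L = ln (1/d), this exhibits \<tau> f as the larger root of y^2 = 2 L (1/3 -
  \<omega>/\<tau>) y + 2 b \<omega> L.\<close>

lemma err_lower_times:
  assumes "0 < \<tau>" "0 < d" "d < 1"
  shows "real \<tau> * err_lower b d \<omega> \<tau>
    = ln (1 / d) * (1 / 3 - real \<omega> / real \<tau>) +
      sqrt ((ln (1 / d) * (1 / 3 - real \<omega> / real \<tau>))\<^sup>2 + 2 * b * real \<omega> * ln (1 / d))"
proof -
  have "0 < ln (1 / d)" using assms by simp
  from scaled_quadratic_root[OF this, symmetric] show ?thesis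
    using assms by (simp add: err_lower_def)
qed

lemma err_upper_times:
  assumes "0 < \<tau>" "0 < d" "d < 1"
  shows "real \<tau> * err_upper b d \<omega> \<tau>
    = ln (1 / d) * (1 / 3 + real \<omega> / real \<tau>) +
      sqrt ((ln (1 / d) * (1 / 3 + real \<omega> / real \<tau>))\<^sup>2 + 2 * b * real \<omega> * ln (1 / d))"
proof -
  have "0 < ln (1 / d)" using assms by simp
  from scaled_quadratic_root[OF this, symmetric] show ?thesis
    using assms by (simp add: err_upper_def)
qed

text \<open>The roots of y^2 = 2 a y + c have product -c \<le> 0, so the larger one is nonnegative.
  This settles deviations in the harmless direction.\<close>

lemma le_plus_sqrt_of_nonpos:
  fixes y a c :: real
  assumes "y \<le> 0" "0 \<le> c"
  shows "y \<le> a + sqrt (a\<^sup>2 + c)"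
proof -
  have "- a \<le> sqrt (a\<^sup>2 + c)"
    using assms by (intro real_le_rsqrt) auto
  with assms show ?thesis by simp
qed

lemma diff_le_err_lower:
  assumes "real \<tau> * (b' - b) < bernstein_threshold (ln (1 / d)) (real \<omega> * b)"
    and "0 < \<tau>" "0 < d" "d < 1" "0 \<le> b" "0 \<le> b'"
  shows "b' - b \<le> err_lower b' d \<omega> \<tau>"
proof -
  define L y where "L = ln (1 / d)" and "y = real \<tau> * (b' - b)"
  have L: "0 < L" using assms by (simp add: L_def)
  have "y \<le> L * (1 / 3 - real \<omega> / real \<tau>) +
      sqrt ((L * (1 / 3 - real \<omega> / real \<tau>))\<^sup>2 + 2 * b' * real \<omega> * L)"
  proof (cases "0 \<le> y")
    case True
    have "y\<^sup>2 \<le> 2 * (L / 3) * y + 2 * (real \<omega> * b) * L"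
      using assms True L by (intro square_le_if_less_bernstein_threshold) (auto simp: L_def y_def)
    \<comment> \<open>Replacing the unknown \<open>b\<close> adds -2 L (\<omega>/\<tau>) y to the
      linear term: hence 1/3 - \<omega>/\<tau> in f, and with the opposite sign of \<open>y\<close>,
      1/3 + \<omega>/\<tau> in g.\<close>
    moreover have "b = b' - y / real \<tau>"
      using assms by (simp add: y_def)
    ultimately show ?thesis
      by (intro le_quadratic_root) (simp add: algebra_simps)
  next
    case False
    then show ?thesis
      using assms L by (intro le_plus_sqrt_of_nonpos) auto
  qed
  then have "real \<tau> * (b' - b) \<le> real \<tau> * err_lower b' d \<omega> \<tau>"
    using assms by (simp add: err_lower_times L_def y_def)
  then show ?thesis using assms by simp
qed

lemma diff_le_err_upper:
  assumes "real \<tau> * (b - b') < bernstein_threshold (ln (1 / d)) (real \<omega> * b)"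
    and "0 < \<tau>" "0 < d" "d < 1" "0 \<le> b" "0 \<le> b'"
  shows "b - b' \<le> err_upper b' d \<omega> \<tau>"
proof -
  define L y where "L = ln (1 / d)" and "y = real \<tau> * (b - b')"
  have L: "0 < L" using assms by (simp add: L_def)
  have "y \<le> L * (1 / 3 + real \<omega> / real \<tau>) +
      sqrt ((L * (1 / 3 + real \<omega> / real \<tau>))\<^sup>2 + 2 * b' * real \<omega> * L)"
  proof (cases "0 \<le> y")
    case True
    have "y\<^sup>2 \<le> 2 * (L / 3) * y + 2 * (real \<omega> * b) * L"
      using assms True L by (intro square_le_if_less_bernstein_threshold) (auto simp: L_def y_def)
    moreover have "b = b' + y / real \<tau>"
      using assms by (simp add: y_def)
    ultimately show ?thesis
      by (intro le_quadratic_root) (simp add: algebra_simps)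
  next
    case False
    then show ?thesis
      using assms L by (intro le_plus_sqrt_of_nonpos) auto
  qed
  then have "real \<tau> * (b - b') \<le> real \<tau> * err_upper b' d \<omega> \<tau>"
    using assms by (simp add: err_upper_times L_def y_def)
  then show ?thesis using assms by simp
qed

section \<open>Sampling a shortest path\<close>

lemma finite_shortest_paths:
  assumes "finite (verts G)"
  shows "finite (shortest_paths G s t)"
proof (rule finite_subset)
  show "shortest_paths G s t \<subseteq> {xs. set xs \<subseteq> verts G \<and> distinct xs}"
    by (auto simp: shortest_paths_def vpath_def vwalk_def)
  show "finite {xs. set xs \<subseteq> verts G \<and> distinct xs}"
    using assms by (rule finite_subset_distinct)
qed

lemma shortest_path_refl:
  assumes "p \<in> shortest_paths G s s"
  shows "p = [s]"
proof -
  have "distinct p" "p \<noteq> []" "hd p = s" "last p = s"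
    using assms by (auto simp: shortest_paths_def vpath_def vwalk_def)
  then show ?thesis
    by (cases p) (auto split: if_splits)
qed

lemma card_distinct_pairs:
  assumes "finite A"
  shows "card {(s, t). s \<in> A \<and> t \<in> A \<and> s \<noteq> t} = card A * card A - card A"
proof -
  have "{(s, t). s \<in> A \<and> t \<in> A \<and> s \<noteq> t} = A \<times> A - (\<lambda>x. (x, x)) ` A"
    by auto
  then show ?thesis
    using assms
    by (simp add: card_Diff_subset card_image inj_on_def image_subset_iff card_cartesian_product)
qed

lemma measure_bind_pmf:
  "measure_pmf.prob (M \<bind> N) A = measure_pmf.expectation M (\<lambda>x. measure_pmf.prob (N x) A)"
proof -
  have "ennreal (measure_pmf.prob (M \<bind> N) A)
      = (\<integral>\<^sup>+ x. ennreal (measure_pmf.prob (N x) A) \<partial>measure_pmf M)"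
    by (simp add: measure_pmf.emeasure_eq_measure[symmetric])
  also have "\<dots> = ennreal (measure_pmf.expectation M (\<lambda>x. measure_pmf.prob (N x) A))"
    by (intro nn_integral_eq_integral measure_pmf.integrable_const_bound[where B = 1]) auto
  finally show ?thesis
    by (simp add: integral_nonneg_AE)
qed

text \<open>The sampled pairs and the pairs summed in \<open>betweenness\<close> differ: the former
  include those with endpoint \<open>v\<close>, the latter those with s = t. Both kinds contribute
  0.\<close>

lemma prob_internal_node_sample_path:
  assumes fin: "finite (verts G)" and n: "2 \<le> card (verts G)"
  shows "measure_pmf.prob (sample_path G) {p. internal_node v p} = betweenness G v"
proof -
  let ?n = "real (card (verts G))"
  let ?Q = "{(s, t). s \<in> verts G \<and> t \<in> verts G \<and> s \<noteq> t}"
  let ?R = "{(s, t). s \<in> verts G \<and> t \<in> verts G \<and> s \<noteq> v \<and> v \<noteq> t}"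
  let ?D = "\<lambda>s t. if shortest_paths G s t = {} then return_pmf []
                   else pmf_of_set (shortest_paths G s t)"
  let ?r = "\<lambda>s t. real (num_sp_through G s t v) / real (num_sp G s t)"
  have finV2: "finite (verts G \<times> verts G)"
    using fin by simp
  have finQ: "finite ?Q" and finR: "finite ?R"
    by (rule finite_subset[OF _ finV2], blast)+
  have "card (verts G) * 2 \<le> card (verts G) * card (verts G)"
    using n by (intro mult_le_mono) auto
  then have card_pos: "0 < card ?Q"
    using card_distinct_pairs[OF fin] n by linarith
  then have neQ: "?Q \<noteq> {}"
    by (metis card.empty less_irrefl)
  have cardQ: "real (card ?Q) = ?n * (?n - 1)"
    by (simp add: card_distinct_pairs[OF fin] of_nat_diff algebra_simps)
  have prob: "measure_pmf.prob (?D s t) {p. internal_node v p}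
      = (if s \<noteq> v \<and> v \<noteq> t then ?r s t else 0)" for s t
  proof (cases "shortest_paths G s t = {}")
    case True
    then show ?thesis
      \<comment> \<open>The empty path has no internal node, and the matching summand is 0 / 0 =
        0.\<close>
      by (simp add: internal_node_def num_sp_def)
  next
    case False
    have "shortest_paths G s t \<inter> {p. internal_node v p}
        = (if s \<noteq> v \<and> v \<noteq> t then {p \<in> shortest_paths G s t. v \<in> set p} else {})"
      by (auto simp: internal_node_def shortest_paths_def)
    then show ?thesis
      using False fin
      by (simp add: measure_pmf_of_set finite_shortest_paths num_sp_def num_sp_through_def)
  qed
  have "measure_pmf.prob (sample_path G) {p. internal_node v p}
      = (\<Sum>(s, t) \<in> ?Q. measure_pmf.prob (?D s t) {p. internal_node v p}) / real (card ?Q)"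
    unfolding sample_path_def measure_bind_pmf
    using finQ neQ by (simp add: integral_pmf_of_set case_prod_unfold)
  also have "(\<Sum>(s, t) \<in> ?Q. measure_pmf.prob (?D s t) {p. internal_node v p})
      = (\<Sum>(s, t) \<in> ?Q. if s \<noteq> v \<and> v \<noteq> t then ?r s t else 0)"
    by (simp only: prob)
  also have "\<dots> = (\<Sum>(s, t) \<in> ?R. ?r s t)"
  proof (rule sum.mono_neutral_cong[OF finR finQ])
    fix x assume "x \<in> ?R - ?Q"
    then obtain s where s: "x = (s, s)" "s \<noteq> v" by auto
    then have "{p \<in> shortest_paths G s s. v \<in> set p} = {}"
      using shortest_path_refl[of _ G s] by force
    then have "num_sp_through G s s v = 0"
      by (simp only: num_sp_through_def card.empty)
    then show "(case x of (s, t) \<Rightarrow> ?r s t) = 0"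
      by (simp add: s)
  qed auto
  finally show ?thesis
    by (simp add: betweenness_def cardQ)
qed

section \<open>The number of samples\<close>

lemma max_samples_factor_pos:
  fixes \<delta> :: real
  assumes "0 < \<delta>" "\<delta> < 1"
  shows "0 < (if k \<le> 2 then 0 else real_of_int \<lfloor>log 2 (real k - 2)\<rfloor>) + 1 + ln (2 / \<delta>)"
proof -
  have "0 < ln (2 / \<delta>)"
    using assms by simp
  moreover have "0 \<le> \<lfloor>log 2 (real k - 2)\<rfloor>" if "\<not> k \<le> 2"
    using that by (simp add: zero_le_log_cancel_iff)
  ultimately show ?thesis by (auto intro!: add_nonneg_pos)
qed

lemma max_samples_pos:
  assumes "0 < c" "0 < \<epsilon>" "0 < \<delta>" "\<delta> < 1"
  shows "0 < max_samples G c \<epsilon> \<delta>"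
  unfolding max_samples_def
  using assms max_samples_factor_pos[of \<delta> "vertex_diameter G"] by simp

text \<open>The factor depending on \<delta> strictly decreases in \<delta>, so a larger failure
  probability pays for a better accuracy.\<close>

lemma max_samples_trade_off:
  assumes "0 < \<epsilon>" "0 < \<delta>" "\<delta> < \<delta>'" "\<delta>' < 1"
  obtains \<epsilon>' where "0 < \<epsilon>'" "\<epsilon>' < \<epsilon>" "max_samples G c \<epsilon>' \<delta>' = max_samples G c \<epsilon> \<delta>"
proof -
  define K where "K d = (if vertex_diameter G \<le> 2 then 0
      else real_of_int \<lfloor>log 2 (real (vertex_diameter G) - 2)\<rfloor>) + 1 + ln (2 / d)" for d
  have pos: "0 < K \<delta>" "0 < K \<delta>'"
    unfolding K_def using assms by (intro max_samples_factor_pos; linarith)+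
  have less: "K \<delta>' < K \<delta>"
    using assms by (simp add: K_def divide_strict_left_mono)
  \<comment> \<open>Solves K(\<delta>') / \<epsilon>'^2 = K(\<delta>) / \<epsilon>^2, so the sample
    numbers agree even before rounding.\<close>
  define \<epsilon>' where "\<epsilon>' = \<epsilon> * sqrt (K \<delta>' / K \<delta>)"
  have "\<epsilon>'\<^sup>2 = \<epsilon>\<^sup>2 * (K \<delta>' / K \<delta>)"
    using pos by (simp add: \<epsilon>'_def power_mult_distrib)
  then have "c / \<epsilon>'\<^sup>2 * K \<delta>' = c / \<epsilon>\<^sup>2 * K \<delta>"
    using pos by simp
  then have "max_samples G c \<epsilon>' \<delta>' = max_samples G c \<epsilon> \<delta>"
    by (simp add: max_samples_def K_def)
  moreover have "0 < \<epsilon>'" "\<epsilon>' < \<epsilon>"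
    using assms pos less by (auto simp: \<epsilon>'_def)
  ultimately show ?thesis by (rule that[rotated -1])
qed

lemma rk_sample_bound_strict:
  assumes rk: "rk_sample_bound G c" and "0 < \<epsilon>" "\<epsilon> < 1" "0 < \<delta>" "\<delta> < 1"
  shows "measure_pmf.prob (replicate_pmf (max_samples G c \<epsilon> \<delta>) (sample_path G))
           {ps. \<forall>v \<in> verts G. \<bar>estimate ps v - betweenness G v\<bar> < \<epsilon>} \<ge> 1 - \<delta> / 2"
    (is "?q \<ge> _")
proof -
  \<comment> \<open>A lower bound on \<delta>, so that the limit from above is taken by comparing
    with every \<delta>' between \<delta> and 1.\<close>
  have "2 * (1 - ?q) \<le> \<delta>"
  proof (rule dense_ge_bounded)
    fix \<delta>' assume \<delta>': "\<delta> < \<delta>'" "\<delta>' < 1"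
    then obtain \<epsilon>' where \<epsilon>': "0 < \<epsilon>'" "\<epsilon>' < \<epsilon>"
      and eq: "max_samples G c \<epsilon>' \<delta>' = max_samples G c \<epsilon> \<delta>"
      using assms max_samples_trade_off by metis
    have "1 - \<delta>' / 2 \<le> measure_pmf.prob (replicate_pmf (max_samples G c \<epsilon>' \<delta>') (sample_path G))
           {ps. \<forall>v \<in> verts G. \<bar>estimate ps v - betweenness G v\<bar> \<le> \<epsilon>'}"
      using rk \<epsilon>' \<delta>' assms unfolding rk_sample_bound_def by simp
    also have "\<dots> \<le> ?q"
      unfolding eq using \<epsilon>' by (intro measure_pmf.finite_measure_mono) fastforce+
    finally show "2 * (1 - ?q) \<le> \<delta>'" by simp
  qed fact
  then show ?thesis by simp
qed

section \<open>Correctness of the estimates\<close>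

lemma estimate_nonneg: "0 \<le> estimate ps v"
  unfolding estimate_def by (intro mult_nonneg_nonneg sum_list_nonneg) auto

lemma sum_list_centered_eq_estimate:
  assumes "ps \<noteq> []"
  shows "(\<Sum>p\<leftarrow>ps. s * (of_bool (internal_node v p) - b))
    = real (length ps) * (s * (estimate ps v - b))"
proof -
  have "(\<Sum>p\<leftarrow>qs. s * (of_bool (internal_node v p) - b))
      = s * ((\<Sum>p\<leftarrow>qs. if internal_node v p then 1 else 0) - real (length qs) * b)" for qs
    by (induction qs) (auto simp: algebra_simps)
  moreover have "real (length ps) * estimate ps v
      = (\<Sum>p\<leftarrow>ps. if internal_node v p then 1 else 0)"
    using assms by (simp add: estimate_def)
  ultimately show ?thesis
    by (simp add: algebra_simps)
qed

theorem theorem1: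
  fixes G :: "('a, 'b) pre_digraph"
    and c \<epsilon> \<delta> :: real
    and \<delta>L \<delta>U :: "'a \<Rightarrow> real"
    and stop :: "'a list list \<Rightarrow> bool"
    and \<omega> :: nat
  assumes "digraph G" and "2 \<le> card (verts G)"
    and "0 < \<epsilon>" and "\<epsilon> < 1" and "0 < \<delta>" and "\<delta> < 1"
    and "rk_sample_bound G c"
    and "\<omega> = max_samples G c \<epsilon> \<delta>"
    and "\<And>v. v \<in> verts G \<Longrightarrow> 0 < \<delta>L v" and "\<And>v. v \<in> verts G \<Longrightarrow> 0 < \<delta>U v"
    and "(\<Sum>v \<in> verts G. \<delta>L v + \<delta>U v) \<le> \<delta> / 2"
  shows "measure_pmf.prob (adaptive_run (sample_path G) stop \<omega> [])
           {ps. (length ps = \<omega> \<longrightarrow>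
                   (\<forall>v \<in> verts G. \<bar>estimate ps v - betweenness G v\<bar> < \<epsilon>)) \<and>
                (length ps < \<omega> \<longrightarrow>
                   (\<forall>v \<in> verts G.
                      - err_lower (estimate ps v) (\<delta>L v) \<omega> (length ps)
                        \<le> betweenness G v - estimate ps v \<and>
                      betweenness G v - estimate ps v
                        \<le> err_upper (estimate ps v) (\<delta>U v) \<omega> (length ps)))}
         \<ge> 1 - \<delta>"
    (is "measure_pmf.prob ?R ?good \<ge> _")
proof -
  let ?V = "verts G" and ?b = "betweenness G"
  let ?far = "\<lambda>ps. \<not> (\<forall>v \<in> ?V. \<bar>estimate ps v - ?b v\<bar> < \<epsilon>)"
  let ?dev = "\<lambda>s d v. {ps. bernstein_threshold (ln (1 / d)) (real \<omega> * ?b v)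
      \<le> (\<Sum>p\<leftarrow>ps. s * (of_bool (internal_node v p) - ?b v))}"
  let ?full = "{ps. length ps = length ([] :: 'a list list) + \<omega> \<and> ?far ps}"
  \<comment> \<open>The failure budget: \<open>?full\<close> costs \<delta>/2 by the sample bound,
    and the tail events cost the sum of all \<delta>L(v) + \<delta>U(v), the other
    \<delta>/2.\<close>
  let ?cover = "?full \<union> (\<Union>v\<in>?V. ?dev 1 (\<delta>L v) v \<union> ?dev (- 1) (\<delta>U v) v)"
  interpret digraph G by fact
  have fin: "finite ?V" by simp
  have b: "?b v = measure_pmf.prob (sample_path G) {p. internal_node v p}" for v
    using prob_internal_node_sample_path[OF fin] assms by simp
  then have b0: "0 \<le> ?b v" for v by simp
  have "\<omega> > 0"
    using assms by (auto simp: rk_sample_bound_def intro: max_samples_pos)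
  \<comment> \<open>Makes ln (1/\<delta>L(v)) and ln (1/\<delta>U(v)) positive, as the Bernstein
    bound and its inversion require.\<close>
  have \<delta>_less: "\<delta>L v < 1 \<and> \<delta>U v < 1" if "v \<in> ?V" for v
  proof -
    have "\<delta>L v + \<delta>U v \<le> (\<Sum>v \<in> ?V. \<delta>L v + \<delta>U v)"
      using assms(9,10) that fin
      by (intro member_le_sum) (auto intro: add_nonneg_nonneg less_imp_le)
    then show ?thesis
      using assms(6,11) assms(9,10)[OF that] by linarith
  qed
  have cover: "ps \<in> ?cover" if ps: "ps \<in> set_pmf ?R" "ps \<notin> ?good" for ps
  proof (rule ccontr)
    assume no: "ps \<notin> ?cover"
    have len: "0 < length ps"
      using length_adaptive_run[OF ps(1)] \<open>\<omega> > 0\<close> by simp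
    have "- err_lower (estimate ps v) (\<delta>L v) \<omega> (length ps) \<le> ?b v - estimate ps v \<and>
        ?b v - estimate ps v \<le> err_upper (estimate ps v) (\<delta>U v) \<omega> (length ps)"
      if v: "v \<in> ?V" for v
    proof -
      have "real (length ps) * (estimate ps v - ?b v)
          < bernstein_threshold (ln (1 / \<delta>L v)) (real \<omega> * ?b v)"
        and "real (length ps) * (?b v - estimate ps v)
          < bernstein_threshold (ln (1 / \<delta>U v)) (real \<omega> * ?b v)"
        \<comment> \<open>Sign 1 excludes overestimation and leads to f; sign -1 excludes
          underestimation and leads to g.\<close>
        using no v len sum_list_centered_eq_estimate[of ps 1 v "?b v"]
          sum_list_centered_eq_estimate[of ps "- 1" v "?b v"] by (auto simp: not_le)
      then have "estimate ps v - ?b v \<le> err_lower (estimate ps v) (\<delta>L v) \<omega> (length ps)"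
        and "?b v - estimate ps v \<le> err_upper (estimate ps v) (\<delta>U v) \<omega> (length ps)"
        using len assms(9,10)[OF v] \<delta>_less[OF v] b0 estimate_nonneg
        by (auto intro!: diff_le_err_lower diff_le_err_upper)
      then show ?thesis by linarith
    qed
    moreover have "\<bar>estimate ps v - ?b v\<bar> < \<epsilon>" if "length ps = \<omega>" "v \<in> ?V" for v
      using no that by auto
    ultimately show False
      using ps(2) by blast
  qed
  have full: "measure_pmf.prob ?R ?full \<le> \<delta> / 2"
  proof -
    have "measure_pmf.prob ?R ?full
        \<le> measure_pmf.prob (replicate_pmf \<omega> (sample_path G)) {qs. ?far ([] @ qs)}"
      by (rule prob_adaptive_run_full_le)
    also have "{qs. ?far ([] @ qs)} = UNIV - {ps. \<forall>v \<in> ?V. \<bar>estimate ps v - ?b v\<bar> < \<epsilon>}"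
      by auto
    also have "measure_pmf.prob (replicate_pmf \<omega> (sample_path G)) \<dots>
        = 1 - measure_pmf.prob (replicate_pmf \<omega> (sample_path G))
            {ps. \<forall>v \<in> ?V. \<bar>estimate ps v - ?b v\<bar> < \<epsilon>}"
      using measure_pmf.prob_compl[of _ "replicate_pmf \<omega> (sample_path G)"] by simp
    also have "\<dots> \<le> \<delta> / 2"
      using rk_sample_bound_strict[OF assms(7,3-6)] assms(8) by simp
    finally show ?thesis .
  qed
  \<comment> \<open>L = ln (1/d) is chosen so that exp (-L) = d.\<close>
  have dev: "measure_pmf.prob ?R (?dev s d v) \<le> d" if "0 < d" "d < 1" "\<bar>s\<bar> = 1" for s d v
    using prob_adaptive_run_bernstein[OF b, of "ln (1 / d)" s] that by (simp add: ln_div)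
  \<comment> \<open>The inclusion is available only on the support of the run, where lists are
    nonempty; hence the almost-everywhere form of monotonicity.\<close>
  have "measure_pmf.prob ?R (- ?good) \<le> measure_pmf.prob ?R ?cover"
    using cover by (intro measure_pmf.finite_measure_mono_AE) (auto simp: AE_measure_pmf_iff)
  also have "\<dots> \<le> measure_pmf.prob ?R ?full
      + measure_pmf.prob ?R (\<Union>v\<in>?V. ?dev 1 (\<delta>L v) v \<union> ?dev (- 1) (\<delta>U v) v)"
    by (intro measure_subadditive) auto
  also have "measure_pmf.prob ?R (\<Union>v\<in>?V. ?dev 1 (\<delta>L v) v \<union> ?dev (- 1) (\<delta>U v) v)
      \<le> (\<Sum>v\<in>?V. measure_pmf.prob ?R (?dev 1 (\<delta>L v) v \<union> ?dev (- 1) (\<delta>U v) v))"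
    using fin by (intro measure_pmf.finite_measure_subadditive_finite) auto
  also have "\<dots> \<le> (\<Sum>v\<in>?V. \<delta>L v + \<delta>U v)"
  proof (rule sum_mono)
    fix v assume v: "v \<in> ?V"
    have "measure_pmf.prob ?R (?dev 1 (\<delta>L v) v \<union> ?dev (- 1) (\<delta>U v) v)
        \<le> measure_pmf.prob ?R (?dev 1 (\<delta>L v) v) + measure_pmf.prob ?R (?dev (- 1) (\<delta>U v) v)"
      by (intro measure_subadditive) auto
    also have "\<dots> \<le> \<delta>L v + \<delta>U v"
      using assms(9,10)[OF v] \<delta>_less[OF v] by (intro add_mono dev) auto
    finally show "measure_pmf.prob ?R (?dev 1 (\<delta>L v) v \<union> ?dev (- 1) (\<delta>U v) v) \<le> \<delta>L v + \<delta>U v" .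
  qed
  finally have "measure_pmf.prob ?R (- ?good) \<le> \<delta>"
    using full assms(11) by linarith
  moreover have "measure_pmf.prob ?R (- ?good) = 1 - measure_pmf.prob ?R ?good"
    using measure_pmf.prob_compl[of ?good ?R] by (simp add: Compl_eq_Diff_UNIV)
  ultimately show ?thesis by linarith
qed

end
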